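(* Let $(\vec b_1,\ldots,\vec b_d)$ be an HKZ-reduced basis of a lattice of dimension $d\ge 2$, with Gram–Schmidt vectors $\vec b_1^*,\ldots,\vec b_d^*$, and let $I\subset\{1,\ldots,d\}$ be nonempty. Then $$\frac{\|\vec b_1\|^{|I|}}{\prod_{i\in I}\|\vec b_i^*\|}\le (\sqrt d)^{|I|\left(1+\log\frac{d}{|I|}\right)}\le (\sqrt d)^{\frac de+|I|}.$$
   Context: Logarithms are natural. Gram–Schmidt orthogonalisation: $\vec b_i^*=\vec b_i-\sum_{j<i}\mu_{i,j}\vec b_j^*$ with $\mu_{i,j}=\langle \vec b_i,\vec b_j^*\rangle/\|\vec b_j^*\|^2$. A basis is size-reduced if $|\mu_{i,j}|\le 1/2$ for all $j<i$. A basis is HKZ-reduced if it is size-reduced, $\vec b_1$ is a shortest nonzero lattice vector, and the projections of $\vec b_2,\ldots,\vec b_d$ orthogonally to $\vec b_1$ form an HKZ-reduced basis. *)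

theory Defs
  imports "HOL-Analysis.Analysis"
begin

text \<open>Bases are lists of vectors; index i of the list (0-based) is the paper's vector b_(i+1).\<close>

function gso :: "'a::euclidean_space list \<Rightarrow> nat \<Rightarrow> 'a" where
  "gso bs i = bs ! i -
     (\<Sum>j<i. ((bs ! i \<bullet> gso bs j) / (norm (gso bs j))\<^sup>2) *\<^sub>R gso bs j)"
  by auto
termination by (relation "Wellfounded.measure snd") auto

definition gs_mu :: "'a::euclidean_space list \<Rightarrow> nat \<Rightarrow> nat \<Rightarrow> real" where
  "gs_mu bs i j = (bs ! i \<bullet> gso bs j) / (norm (gso bs j))\<^sup>2"

definition lattice_of :: "'a::euclidean_space list \<Rightarrow> 'a set" where
  "lattice_of bs = {(\<Sum>i<length bs. of_int (z i) *\<^sub>R bs ! i) | z. True}"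

definition is_basis :: "'a::euclidean_space list \<Rightarrow> bool" where
  "is_basis bs \<longleftrightarrow> distinct bs \<and> \<not> dependent (set bs)"

definition size_reduced :: "'a::euclidean_space list \<Rightarrow> bool" where
  "size_reduced bs \<longleftrightarrow> (\<forall>i<length bs. \<forall>j<i. \<bar>gs_mu bs i j\<bar> \<le> 1/2)"

definition shortest_in :: "'a::real_normed_vector \<Rightarrow> 'a set \<Rightarrow> bool" where
  "shortest_in v L \<longleftrightarrow> v \<in> L \<and> v \<noteq> 0 \<and> (\<forall>w\<in>L. w \<noteq> 0 \<longrightarrow> norm v \<le> norm w)"

definition proj_orth :: "'a::euclidean_space \<Rightarrow> 'a \<Rightarrow> 'a" where
  "proj_orth b v = v - ((v \<bullet> b) / (norm b)\<^sup>2) *\<^sub>R b"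

function hkz_reduced :: "'a::euclidean_space list \<Rightarrow> bool" where
  "hkz_reduced [] = True"
| "hkz_reduced (b # bs) \<longleftrightarrow>
     size_reduced (b # bs) \<and> shortest_in b (lattice_of (b # bs)) \<and>
     hkz_reduced (map (proj_orth b) bs)"
  by pat_completeness auto
termination by (relation "Wellfounded.measure length") auto

end

theory Submission
  imports Defs
begin

text \<open>
  Write \<open>x i = ln (norm (gso bs i))\<close>. Every block \<open>i..j\<close> of an HKZ-reduced basis is again
  HKZ-reduced, so a bound on the Hermite constant of dimension \<open>n = j - i + 1 \<le> d\<close> gives
  \<open>x i \<le> c + average of x over i+1..j\<close> with \<open>c = ln (sqrt d)\<close>.

  For a level \<open>v \<le> x 0\<close>, every maximal run of indices with \<open>x < v\<close> is preceded by an index with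
  \<open>x \<ge> v\<close>; hence the average of \<open>x\<close> over \<open>{i. x i < v}\<close> is at least \<open>v - c\<close>. In other words, the
  decreasing rearrangement of \<open>min (x i) (x 0)\<close> satisfies the same inequalities, and for a
  decreasing sequence the average of the \<open>n\<close> smallest terms exceeds that of the \<open>n - 1\<close> smallest
  by at most \<open>c / n\<close>. Summing these increments from \<open>card I\<close> to \<open>d\<close> yields the logarithm.
\<close>

section \<open>Gram-Schmidt orthogonality and coordinates of lattice vectors\<close>

declare gso.simps [simp del]

lemma gso_0: "gso bs 0 = bs ! 0"
  by (subst gso.simps) simp

lemma gso_orthogonal_less: "j < i \<Longrightarrow> gso bs i \<bullet> gso bs j = 0"
proof (induction i arbitrary: j rule: less_induct)
  case (less i)
  have orth: "gso bs l \<bullet> gso bs j = 0" if "l < i" "l \<noteq> j" for l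
    using less.IH[of l j] less.IH[of j l] less.prems that
    by (cases "l < j") (auto simp: inner_commute)
  have "(\<Sum>l<i. ((bs ! i \<bullet> gso bs l) / (norm (gso bs l))\<^sup>2) * (gso bs l \<bullet> gso bs j))
      = (\<Sum>l\<in>{j}. ((bs ! i \<bullet> gso bs l) / (norm (gso bs l))\<^sup>2) * (gso bs l \<bullet> gso bs j))"
    using less.prems by (intro sum.mono_neutral_right) (auto simp: orth)
  \<comment> \<open>If \<open>gso bs j\<close> is zero, the quotient is 0 by division by zero, and
    both sides vanish.\<close>
  also have "\<dots> = bs ! i \<bullet> gso bs j"
    by (cases "gso bs j = 0") (simp_all add: dot_square_norm)
  finally show ?case
    by (subst gso.simps) (simp add: inner_diff_left inner_sum_left)
qed

lemma gso_orthogonal: "i \<noteq> j \<Longrightarrow> gso bs i \<bullet> gso bs j = 0"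
  by (metis gso_orthogonal_less inner_commute linorder_neqE_nat)

lemma nth_eq_gso_sum:
  "bs ! i = gso bs i + (\<Sum>j<i. ((bs ! i \<bullet> gso bs j) / (norm (gso bs j))\<^sup>2) *\<^sub>R gso bs j)"
  using gso.simps[of bs i] by (simp add: algebra_simps)

lemma nth_inner_gso:
  assumes "i \<le> l"
  shows "bs ! i \<bullet> gso bs l = (if i = l then (norm (gso bs l))\<^sup>2 else 0)"
proof -
  have "(\<Sum>j<i. ((bs ! i \<bullet> gso bs j) / (norm (gso bs j))\<^sup>2) * (gso bs j \<bullet> gso bs l)) = 0"
    using assms by (intro sum.neutral) (auto simp: gso_orthogonal)
  hence "bs ! i \<bullet> gso bs l = gso bs i \<bullet> gso bs l"
    by (subst nth_eq_gso_sum) (simp add: inner_add_left inner_sum_left)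
  thus ?thesis by (simp add: gso_orthogonal dot_square_norm)
qed

text \<open>Both sides are linear in \<open>v\<close>, so it suffices to take
  \<open>v = bs ! i\<close>. There the coefficients beyond \<open>i\<close> vanish and what remains
  is the defining recursion of \<open>gso\<close>.\<close>

lemma gso_expansion:
  assumes "v \<in> lattice_of bs"
  shows "v = (\<Sum>l<length bs. ((v \<bullet> gso bs l) / (norm (gso bs l))\<^sup>2) *\<^sub>R gso bs l)"
proof -
  define E where "E = (\<lambda>v. \<Sum>l<length bs. ((v \<bullet> gso bs l) / (norm (gso bs l))\<^sup>2) *\<^sub>R gso bs l)"
  have lin: "linear E"
    unfolding E_def
    by (intro linearI)
       (simp_all add: inner_add_left add_divide_distrib scaleR_add_left sum.distrib scaleR_sum_right)
  have base: "E (bs ! i) = bs ! i" if "i < length bs" for i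
  proof -
    have "E (bs ! i) = (\<Sum>l\<in>insert i {..<i}. ((bs ! i \<bullet> gso bs l) / (norm (gso bs l))\<^sup>2) *\<^sub>R gso bs l)"
      unfolding E_def using that
      by (intro sum.mono_neutral_right) (auto simp: nth_inner_gso)
    also have "\<dots> = gso bs i + (\<Sum>l<i. ((bs ! i \<bullet> gso bs l) / (norm (gso bs l))\<^sup>2) *\<^sub>R gso bs l)"
      by (cases "gso bs i = 0") (simp_all add: nth_inner_gso)
    also have "\<dots> = bs ! i" by (rule nth_eq_gso_sum [symmetric])
    finally show ?thesis .
  qed
  obtain z :: "nat \<Rightarrow> int" where v: "v = (\<Sum>i<length bs. of_int (z i) *\<^sub>R bs ! i)"
    using assms by (auto simp: lattice_of_def)
  have "E v = v"
    unfolding v by (simp add: linear_sum[OF lin] linear_cmul[OF lin] base)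
  thus ?thesis by (simp add: E_def)
qed

lemma norm_lattice_vector:
  assumes "v \<in> lattice_of bs"
  shows "(norm v)\<^sup>2 = (\<Sum>l<length bs. (v \<bullet> gso bs l)\<^sup>2 / (norm (gso bs l))\<^sup>2)"
proof -
  have "(norm v)\<^sup>2 = v \<bullet> v" by (simp add: dot_square_norm)
  also have "\<dots> = v \<bullet> (\<Sum>l<length bs. ((v \<bullet> gso bs l) / (norm (gso bs l))\<^sup>2) *\<^sub>R gso bs l)"
    using gso_expansion[OF assms] by simp
  also have "\<dots> = (\<Sum>l<length bs. (v \<bullet> gso bs l)\<^sup>2 / (norm (gso bs l))\<^sup>2)"
    by (simp add: inner_sum_right power2_eq_square)
  finally show ?thesis .
qed

section \<open>Projection along the first basis vector and minimality in HKZ-reduced bases\<close>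

lemma inner_proj_orth: "w \<bullet> b = 0 \<Longrightarrow> proj_orth b v \<bullet> w = v \<bullet> w"
  by (simp add: proj_orth_def inner_diff_left inner_commute[of b w])

text \<open>In the recursion for \<open>Suc i\<close>, the term of index 0 is exactly what
  \<open>proj_orth b\<close> subtracts. The other coefficients do not change, because the later
  Gram-Schmidt vectors are orthogonal to \<open>b\<close>.\<close>

lemma gso_map_proj_orth:
  "i < length bs \<Longrightarrow> gso (map (proj_orth b) bs) i = gso (b # bs) (Suc i)"
proof (induction i rule: less_induct)
  case (less i)
  have IH: "gso (map (proj_orth b) bs) j = gso (b # bs) (Suc j)" if "j < i" for j
    using less that by simp
  have orth: "gso (b # bs) (Suc j) \<bullet> b = 0" for j
    using gso_orthogonal[of "Suc j" 0 "b # bs"] by (simp add: gso_0)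
  have "b \<bullet> gso (b # bs) (Suc j) = 0" for j
    using orth[of j] by (simp add: inner_commute)
  thus ?case
    using less.prems
    by (subst (1 2) gso.simps)
       (simp add: IH inner_diff_left sum.lessThan_Suc_shift gso_0 proj_orth_def
          del: sum.lessThan_Suc)
qed

lemma linear_proj_orth: "linear (proj_orth b)"
  by (intro linearI) (simp_all add: proj_orth_def inner_add_left add_divide_distrib algebra_simps)

lemma proj_orth_lattice:
  assumes "v \<in> lattice_of (b # bs)"
  shows "proj_orth b v \<in> lattice_of (map (proj_orth b) bs)"
proof -
  obtain z :: "nat \<Rightarrow> int" where v: "v = (\<Sum>i<length (b # bs). of_int (z i) *\<^sub>R (b # bs) ! i)"
    using assms by (auto simp: lattice_of_def)
  have [simp]: "proj_orth b b = 0" by (cases "b = 0") (simp_all add: proj_orth_def dot_square_norm)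
  have "proj_orth b v = (\<Sum>i<length bs. of_int (z (Suc i)) *\<^sub>R map (proj_orth b) bs ! i)"
    unfolding v
    by (simp add: linear_sum[OF linear_proj_orth] linear_cmul[OF linear_proj_orth]
          linear_add[OF linear_proj_orth] sum.lessThan_Suc_shift del: sum.lessThan_Suc)
  thus ?thesis by (auto simp: lattice_of_def intro!: exI[of _ "\<lambda>i. z (Suc i)"])
qed

text \<open>The heads of the successively projected lists are the Gram-Schmidt vectors, and
  \<open>shortest_in\<close> makes each head nonzero.\<close>

lemma hkz_gso_nonzero: "hkz_reduced bs \<Longrightarrow> i < length bs \<Longrightarrow> gso bs i \<noteq> 0"
proof (induction bs arbitrary: i rule: hkz_reduced.induct)
  case (2 b bs)
  show ?case
  proof (cases i)
    case 0
    thus ?thesis using 2 by (simp add: gso_0 shortest_in_def)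
  next
    case (Suc k)
    thus ?thesis using 2 by (simp flip: gso_map_proj_orth)
  qed
qed simp

text \<open>The sum on the right is the squared norm of the projection of \<open>v\<close> orthogonally to the
  first \<open>i\<close> basis vectors.\<close>

lemma hkz_gso_minimal:
  assumes "hkz_reduced bs" "v \<in> lattice_of bs" "i \<le> l" "l < length bs" "v \<bullet> gso bs l \<noteq> 0"
  shows "(norm (gso bs i))\<^sup>2 \<le> (\<Sum>l=i..<length bs. (v \<bullet> gso bs l)\<^sup>2 / (norm (gso bs l))\<^sup>2)"
  using assms
proof (induction bs arbitrary: v i l rule: hkz_reduced.induct)
  case (2 b bs)
  show ?case
  proof (cases i)
    case 0
    have "v \<noteq> 0" using 2 by auto
    hence "norm b \<le> norm v" using 2 by (simp add: shortest_in_def)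
    hence "(norm b)\<^sup>2 \<le> (norm v)\<^sup>2" by (simp add: power_mono)
    also have "\<dots> = (\<Sum>l<length (b # bs). (v \<bullet> gso (b # bs) l)\<^sup>2 / (norm (gso (b # bs) l))\<^sup>2)"
      using 2 by (intro norm_lattice_vector)
    finally show ?thesis by (simp add: 0 gso_0 atLeast0LessThan)
  next
    case (Suc k)
    have orth: "gso (b # bs) (Suc j) \<bullet> b = 0" for j
      using gso_orthogonal[of "Suc j" 0 "b # bs"] by (simp add: gso_0)
    \<comment> \<open>The index \<open>l\<close> certifies that the projected vector is nonzero. It
      moves down by one, and the coordinate there survives since \<open>proj_orth b\<close>
      preserves inner products with vectors orthogonal to \<open>b\<close>.\<close>
    obtain m where m: "l = Suc m" using 2 Suc by (cases l) auto
    let ?bs = "map (proj_orth b) bs"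
    have "(norm (gso ?bs k))\<^sup>2
        \<le> (\<Sum>l=k..<length ?bs. (proj_orth b v \<bullet> gso ?bs l)\<^sup>2 / (norm (gso ?bs l))\<^sup>2)"
    proof (rule "2.IH")
      show "hkz_reduced ?bs" using 2 by simp
      show "proj_orth b v \<in> lattice_of ?bs" using 2 by (intro proj_orth_lattice)
      show "k \<le> m" "m < length ?bs" using 2 m Suc by auto
      thus "proj_orth b v \<bullet> gso ?bs m \<noteq> 0"
        using 2 m by (simp add: gso_map_proj_orth inner_proj_orth[OF orth])
    qed
    also have "\<dots> = (\<Sum>l=k..<length bs. (v \<bullet> gso (b # bs) (Suc l))\<^sup>2 / (norm (gso (b # bs) (Suc l)))\<^sup>2)"
      by (simp add: gso_map_proj_orth inner_proj_orth[OF orth])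
    also have "\<dots> = (\<Sum>l=i..<length (b # bs). (v \<bullet> gso (b # bs) l)\<^sup>2 / (norm (gso (b # bs) l))\<^sup>2)"
      by (simp only: Suc list.size sum.shift_bounds_Suc_ivl add_Suc_right add_0_right)
    finally show ?thesis using 2 m by (simp add: gso_map_proj_orth Suc)
  qed
qed simp

section \<open>Short vectors from a pigeonhole argument\<close>

lemma pigeonhole_three:
  assumes "finite A" "finite B" "f ` A \<subseteq> B" "2 * card B < card A"
  obtains a b c where "a \<in> A" "b \<in> A" "c \<in> A" "a \<noteq> b" "b \<noteq> c" "a \<noteq> c" "f a = f b" "f b = f c"
proof -
  have "\<exists>y\<in>B. 3 \<le> card {x\<in>A. f x = y}"
  proof (rule ccontr)
    assume "\<not> ?thesis"
    hence "(\<Sum>y\<in>B. card {x\<in>A. f x = y}) \<le> (\<Sum>y\<in>B. 2)"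
      by (intro sum_mono) (auto simp: not_le less_Suc_eq_le numeral_3_eq_3 numeral_2_eq_2)
    moreover have "(\<Sum>y\<in>B. card {x\<in>A. f x = y}) = card A"
      using sum.group[OF assms(1-3), of "\<lambda>_. 1::nat"] by simp
    ultimately show False using assms(4) by simp
  qed
  then obtain y T where T: "T \<subseteq> {x\<in>A. f x = y}" "card T = 3"
    by (metis obtain_subset_with_card_n)
  then obtain a b c where "T = {a, b, c}" "a \<noteq> b" "b \<noteq> c" "a \<noteq> c"
    by (auto simp: card_3_iff)
  with T that[of a b c] show ?thesis by auto
qed

text \<open>For ordered points the two inner squares add up to at most the outer one, the cross term
  being nonnegative. Hence the factor 2 instead of the trivial 3.\<close>

lemma sum_three_squared_differences_less:
  fixes a b c t :: real
  assumes "\<bar>a - b\<bar> < t" "\<bar>b - c\<bar> < t" "\<bar>a - c\<bar> < t"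
  shows "(a - b)\<^sup>2 + (b - c)\<^sup>2 + (a - c)\<^sup>2 < 2 * t\<^sup>2"
proof -
  have *: "(p - q)\<^sup>2 + (q - s)\<^sup>2 + (p - s)\<^sup>2 < 2 * t\<^sup>2" if "p \<le> q" "q \<le> s" "s - p < t" for p q s
  proof -
    have "(q - p) * (s - q) \<ge> 0" using that by simp
    hence "(p - q)\<^sup>2 + (q - s)\<^sup>2 \<le> (s - p)\<^sup>2" by (simp add: power2_eq_square algebra_simps)
    moreover have "(s - p)\<^sup>2 < t\<^sup>2" using that by (intro power_strict_mono) auto
    ultimately show ?thesis by (simp add: power2_commute[of p s])
  qed
  consider "a \<le> b" "b \<le> c" | "a \<le> c" "c \<le> b" | "b \<le> a" "a \<le> c"
    | "b \<le> c" "c \<le> a" | "c \<le> a" "a \<le> b" | "c \<le> b" "b \<le> a" by linarith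
  thus ?thesis
    using *[of a b c] *[of a c b] *[of b a c] *[of b c a] *[of c a b] *[of c b a] assms
    by cases (simp_all add: power2_commute[of b a] power2_commute[of c b] power2_commute[of c a])
qed

lemma abs_diff_less_if_floor_divide_eq:
  fixes a b t :: real
  assumes "t > 0" "\<lfloor>a / t\<rfloor> = \<lfloor>b / t\<rfloor>"
  shows "\<bar>a - b\<bar> < t"
proof -
  have "\<bar>a / t - b / t\<bar> < 1" using assms(2) by linarith
  thus ?thesis using assms(1) by (simp add: abs_divide flip: diff_divide_distrib)
qed

lemma floor_multiple_tendsto:
  fixes y :: real
  shows "(\<lambda>M. \<lfloor>real M * y\<rfloor> / real M) \<longlonglongrightarrow> y"
proof (rule tendsto_sandwich)
  show "\<forall>\<^sub>F M in sequentially. y - 1 / real M \<le> \<lfloor>real M * y\<rfloor> / real M"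
    using eventually_gt_at_top[of 0]
  proof eventually_elim
    case (elim M)
    have "real M * y - 1 \<le> \<lfloor>real M * y\<rfloor>" by linarith
    hence "(real M * y - 1) / real M \<le> \<lfloor>real M * y\<rfloor> / real M" by (simp add: divide_right_mono)
    thus ?case using elim by (simp add: diff_divide_distrib)
  qed
  show "\<forall>\<^sub>F M in sequentially. \<lfloor>real M * y\<rfloor> / real M \<le> y"
    using eventually_gt_at_top[of 0] by eventually_elim (simp add: field_simps)
  show "(\<lambda>M. y - 1 / real M) \<longlonglongrightarrow> y"
    using tendsto_diff[OF tendsto_const lim_1_over_n] by simp
qed simp

text \<open>A large box with \<open>M\<close> cells of side \<open>t\<close> in each direction contains, by \<open>digits\<close>, more
  than \<open>2 M ^ card S\<close> points of \<open>L\<close>, hence three points in one cell. The mean of the three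
  squared distances is smaller than two thirds of the squared diameter of the cell; this factor
  \<open>2/3\<close> is what two points per cell (Minkowski's theorem for the cube) would not give.\<close>

lemma exists_short_vector:
  fixes L :: "('i \<Rightarrow> real) set" and r :: "'i \<Rightarrow> real" and t :: real
  assumes S: "finite S" "S \<noteq> {}" and r: "\<And>l. l \<in> S \<Longrightarrow> r l > 0" and t: "t > 0"
    and vol: "2 * (\<Prod>l\<in>S. r l) < t ^ card S"
    and digits: "\<And>k :: 'i \<Rightarrow> int. \<exists>c\<in>L. \<forall>l\<in>S. \<lfloor>c l / r l\<rfloor> = k l"
    and diff: "\<And>a b. a \<in> L \<Longrightarrow> b \<in> L \<Longrightarrow> (\<lambda>l. a l - b l) \<in> L"
  shows "\<exists>c\<in>L. (\<exists>l\<in>S. c l \<noteq> 0) \<and> 3 * (\<Sum>l\<in>S. (c l)\<^sup>2) < 2 * real (card S) * t\<^sup>2"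
proof -
  \<comment> \<open>The box has side \<open>M * t\<close>, but in direction \<open>l\<close> only a
    whole number of steps of length \<open>r l\<close> is used. The relative loss tends to 0, so the
    strict inequality \<open>vol\<close> survives for some \<open>M\<close>.\<close>
  have "(\<lambda>M. \<Prod>l\<in>S. \<lfloor>real M * (t / r l)\<rfloor> / real M) \<longlonglongrightarrow> (\<Prod>l\<in>S. t / r l)"
    by (intro tendsto_prod floor_multiple_tendsto)
  moreover have "(\<Prod>l\<in>S. t / r l) > 2"
    using vol r by (simp add: prod_dividef less_divide_eq prod_pos)
  ultimately have "\<forall>\<^sub>F M in sequentially. 2 < (\<Prod>l\<in>S. \<lfloor>real M * (t / r l)\<rfloor> / real M)"
    by (rule order_tendstoD)
  from eventually_conj[OF this eventually_gt_at_top[of 0]]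
  obtain M :: nat where M: "2 < (\<Prod>l\<in>S. \<lfloor>real M * (t / r l)\<rfloor> / real M)" "M > 0"
    by (auto simp: eventually_sequentially)
  define s where "s = (\<lambda>l. \<lfloor>real M * (t / r l)\<rfloor>)"
  have s: "s l \<ge> 0" if "l \<in> S" for l
    using r[OF that] t by (simp add: s_def)
  \<comment> \<open>\<open>A\<close> consists of the digit vectors, each giving one point of
    \<open>L\<close> in the box; \<open>B\<close> enumerates the cells of side
    \<open>t\<close>.\<close>
  define A where "A = Pi\<^sub>E S (\<lambda>l. {0..<s l})"
  define B where "B = Pi\<^sub>E S (\<lambda>l. {0..<int M})"
  have fin: "finite A" "finite B" using S by (auto simp: A_def B_def intro!: finite_PiE)
  have "real (2 * card B) = 2 * real M ^ card S"
    using S by (simp add: B_def card_PiE)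
  also have "\<dots> < (\<Prod>l\<in>S. real_of_int (s l))"
    using M by (simp add: prod_dividef less_divide_eq s_def)
  also have "\<dots> = real (card A)"
    using S s by (simp add: A_def card_PiE)
  finally have card: "2 * card B < card A" by linarith
  obtain pt where pt: "\<And>k. pt k \<in> L" "\<And>k l. l \<in> S \<Longrightarrow> \<lfloor>pt k l / r l\<rfloor> = k l"
    using digits by metis
  define cell where "cell = (\<lambda>k. \<lambda>l\<in>S. \<lfloor>pt k l / t\<rfloor>)"
  have "cell ` A \<subseteq> B"
  proof (safe, unfold B_def, rule PiE_I)
    fix k l assume k: "k \<in> A" and l: "l \<in> S"
    have k01: "0 \<le> k l" "k l + 1 \<le> s l" using k l by (auto simp: A_def PiE_def Pi_def)
    have "real_of_int (k l) \<le> pt k l / r l" "pt k l / r l < real_of_int (k l) + 1"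
      using pt(2)[OF l, of k] by linarith+
    moreover have "real_of_int (s l) \<le> real M * (t / r l)" by (simp add: s_def)
    ultimately have "0 \<le> pt k l / r l" "pt k l / r l < real M * (t / r l)"
      using k01 by linarith+
    hence "0 \<le> pt k l" "pt k l < real M * t"
      using r[OF l] by (simp_all add: field_simps)
    thus "cell k l \<in> {0..<int M}"
      using t l by (simp add: cell_def floor_less_iff field_simps)
  qed (auto simp: cell_def)
  from pigeonhole_three[OF fin this card] obtain a b c where abc: "a \<in> A" "b \<in> A" "c \<in> A"
    "a \<noteq> b" "b \<noteq> c" "a \<noteq> c" "cell a = cell b" "cell b = cell c"
    by blast
  \<comment> \<open>Elements of \<open>A\<close> are extensional, so distinct ones differ inside
    \<open>S\<close>; there the floors separate the two points.\<close>
  have distinct: "\<exists>l\<in>S. pt k l - pt k' l \<noteq> 0" if "k \<in> A" "k' \<in> A" "k \<noteq> k'" for k k'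
  proof -
    have "\<exists>l\<in>S. k l \<noteq> k' l"
    proof (rule ccontr)
      assume "\<not> ?thesis"
      hence "k = k'" using that(1,2) unfolding A_def by (intro PiE_ext[of k S]) auto
      thus False using that(3) by simp
    qed
    then obtain l where "l \<in> S" "k l \<noteq> k' l" by blast
    hence "pt k l \<noteq> pt k' l" using pt(2)[of l k] pt(2)[of l k'] by auto
    thus ?thesis using \<open>l \<in> S\<close> by auto
  qed
  have near: "\<bar>pt k l - pt k' l\<bar> < t" if "cell k = cell k'" "l \<in> S" for k k' l
  proof (rule abs_diff_less_if_floor_divide_eq[OF t])
    show "\<lfloor>pt k l / t\<rfloor> = \<lfloor>pt k' l / t\<rfloor>" using fun_cong[OF that(1), of l] that(2) by (simp add: cell_def)
  qed
  define D where "D = (\<lambda>k k'. \<Sum>l\<in>S. (pt k l - pt k' l)\<^sup>2)"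
  have "D a b + D b c + D a c
      = (\<Sum>l\<in>S. (pt a l - pt b l)\<^sup>2 + (pt b l - pt c l)\<^sup>2 + (pt a l - pt c l)\<^sup>2)"
    by (simp add: D_def sum.distrib)
  also have "\<dots> < (\<Sum>l\<in>S. 2 * t\<^sup>2)"
    using S abc near by (intro sum_strict_mono sum_three_squared_differences_less) auto
  finally have "D a b + D b c + D a c < 2 * real (card S) * t\<^sup>2" by simp
  then consider "3 * D a b < 2 * real (card S) * t\<^sup>2" | "3 * D b c < 2 * real (card S) * t\<^sup>2"
    | "3 * D a c < 2 * real (card S) * t\<^sup>2" by linarith
  hence "\<exists>k\<in>A. \<exists>k'\<in>A. k \<noteq> k' \<and> 3 * D k k' < 2 * real (card S) * t\<^sup>2"
    using abc(1-6) by cases metis+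
  then obtain k k' where k: "k \<in> A" "k' \<in> A" "k \<noteq> k'" "3 * D k k' < 2 * real (card S) * t\<^sup>2"
    by blast
  show ?thesis
    using distinct[OF k(1-3)] k(4) unfolding D_def
    by (intro bexI[OF _ diff[OF pt(1) pt(1), of k k']] conjI)
qed

section \<open>Real sequences bounded by averages of the terms that follow\<close>

text \<open>Induction on \<open>n\<close> peels off the last run below \<open>v\<close>: the index
  \<open>p\<close> before it has \<open>x p\<close> at least \<open>v\<close>, so
  \<open>step\<close> bounds the average of the run from below by \<open>v - c\<close>. The sum form
  avoids dividing by the size of a possibly empty set.\<close>

lemma sum_below_level_nonneg:
  fixes x :: "nat \<Rightarrow> real" and c v :: real
  assumes step: "\<And>i j. i < j \<Longrightarrow> j < d \<Longrightarrow> real (j - i) * (x i - c) \<le> (\<Sum>l\<in>{i<..j}. x l)"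
    and v: "v \<le> x 0" and n: "n \<le> d"
  shows "0 \<le> (\<Sum>i | i < n \<and> x i < v. x i - v + c)"
  using n
proof (induction n rule: less_induct)
  case (less n)
  show ?case
  proof (cases "\<forall>i<n. \<not> x i < v")
    case True
    hence empty: "{i. i < n \<and> x i < v} = {}" by auto
    show ?thesis unfolding empty by simp
  next
    case False
    hence "n > 0" by auto
    define p where "p = Max {i. i < n \<and> v \<le> x i}"
    \<comment> \<open>Index 0 belongs to this set, by \<open>v\<close>.\<close>
    have "p \<in> {i. i < n \<and> v \<le> x i}"
      unfolding p_def using v \<open>n > 0\<close> by (intro Max_in) auto
    hence p: "p < n" "v \<le> x p" by auto
    have below: "x i < v" if "p < i" "i < n" for i
    proof (rule ccontr)
      assume "\<not> x i < v"
      hence "i \<le> p" unfolding p_def using that by (intro Max_ge) auto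
      thus False using that by simp
    qed
    have split: "{i. i < n \<and> x i < v} = {i. i < p \<and> x i < v} \<union> {p<..n-1}"
      using p below \<open>n > 0\<close>
    proof (safe, goal_cases)
      case (1 i)
      thus ?case by (cases i p rule: linorder_cases) auto
    qed (force intro: below)+
    have "0 \<le> (\<Sum>i\<in>{p<..n-1}. x i - v + c)"
    proof (cases "p = n - 1")
      case False
      have "real (n - 1 - p) * (v - c) \<le> real (n - 1 - p) * (x p - c)"
        using p by (intro mult_left_mono) auto
      also have "\<dots> \<le> (\<Sum>l\<in>{p<..n-1}. x l)"
        using False p less.prems by (intro step) auto
      finally show ?thesis by (simp add: sum.distrib sum_subtractf algebra_simps)
    qed simp
    moreover have "0 \<le> (\<Sum>i | i < p \<and> x i < v. x i - v + c)"
      using p less by auto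
    ultimately show ?thesis
      unfolding split by (subst sum.union_disjoint) auto
  qed
qed

text \<open>Replacing \<open>1 / n\<close> by a difference of logarithms lets the increments
  telescope.\<close>

lemma inverse_le_ln_ratio:
  fixes n :: nat
  assumes "n \<ge> 2"
  shows "1 / real n \<le> ln (real n / real (n - 1))"
proof -
  have "ln (real (n - 1) / real n) \<le> real (n - 1) / real n - 1"
    using assms by (intro ln_le_minus_one) simp
  thus ?thesis using assms by (simp add: ln_div of_nat_diff field_simps)
qed

text \<open>Removing a maximal element \<open>e\<close> from \<open>A\<close> lowers the average by at most
  \<open>c / card A \<le> c * ln (card A / (card A - 1))\<close>. When \<open>e\<close> lies in \<open>J\<close>, exchanging it for an
  element outside \<open>J\<close> does not increase the average over \<open>J\<close>.\<close>

lemma average_le_subset_average: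
  fixes f :: "'i \<Rightarrow> real" and c :: real
  assumes "finite A" "J \<subseteq> A" "J \<noteq> {}" "c \<ge> 0"
    and "\<And>e. e \<in> A \<Longrightarrow> 0 \<le> (\<Sum>i | i \<in> A \<and> f i < f e. f i - f e + c)"
  shows "sum f A / real (card A) \<le> sum f J / real (card J) + c * ln (real (card A) / real (card J))"
  using assms
proof (induction "card A" arbitrary: A J rule: less_induct)
  case (less A J)
  note finA = less.prems(1) and JA = less.prems(2) and c = less.prems(4) and lev = less.prems(5)
  have finJ: "finite J" using finA JA finite_subset by blast
  show ?case
  proof (cases "J = A")
    case True
    thus ?thesis using less.prems by simp
  next
    case False
    have "\<exists>e\<in>A. \<forall>i\<in>A. f i \<le> f e"
    proof -
      have "A \<noteq> {}" using less.prems by auto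
      hence "Max (f ` A) \<in> f ` A" using finA by (intro Max_in) auto
      thus ?thesis using finA by (metis (no_types, lifting) Max_ge finite_imageI image_iff)
    qed
    then obtain e where e: "e \<in> A" "\<And>i. i \<in> A \<Longrightarrow> f i \<le> f e" by blast
    have "\<exists>K. K \<subseteq> A - {e} \<and> K \<noteq> {} \<and> card K = card J \<and> sum f K \<le> sum f J"
    proof (cases "e \<in> J")
      case True
      obtain e' where e': "e' \<in> A" "e' \<notin> J" using False JA by auto
      have "card (insert e' (J - {e})) = card J"
        using True e' finJ by (simp add: card_Suc_Diff1 del: card_Diff_insert card_Diff_singleton)
      moreover have "sum f (insert e' (J - {e})) \<le> sum f J"
        using True e' e(2)[of e'] finJ by (simp add: sum_diff1)
      moreover have "insert e' (J - {e}) \<subseteq> A - {e}"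
        using True e' JA by auto
      ultimately show ?thesis by blast
    next
      case False
      thus ?thesis using JA less.prems(3) by (intro exI[of _ J]) auto
    qed
    then obtain K where K: "K \<subseteq> A - {e}" "K \<noteq> {}" "card K = card J" "sum f K \<le> sum f J"
      by blast
    define A' where "A' = A - {e}"
    define n where "n = card A"
    have finA': "finite A'" using finA by (simp add: A'_def)
    have cardA': "card A' = n - 1" using e finA by (simp add: A'_def n_def)
    have "card A' \<noteq> 0" using K finA' by (auto simp: A'_def)
    hence n2: "n \<ge> 2" using cardA' by simp
    have cJ: "card J > 0" using finJ less.prems(3) by (simp add: card_gt_0_iff)
    have IH: "sum f A' / real (card A') \<le> sum f K / real (card K) + c * ln (real (card A') / real (card K))"
    proof (rule less.hyps)
      show "card A' < card A" using cardA' n2 by (simp add: n_def)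
      fix a assume a: "a \<in> A'"
      \<comment> \<open>The maximal element \<open>e\<close> is never strictly below a level
        \<open>f a\<close>, so its removal keeps the hypothesis on levels.\<close>
      have "{i. i \<in> A' \<and> f i < f a} = {i. i \<in> A \<and> f i < f a}"
        using e(2)[of a] a by (auto simp: A'_def)
      thus "0 \<le> (\<Sum>i | i \<in> A' \<and> f i < f a. f i - f a + c)"
        using lev[of a] a by (simp add: A'_def)
    qed (use K c finA' in \<open>auto simp: A'_def\<close>)
    have "0 \<le> (\<Sum>i | i \<in> A \<and> f i < f e. f i - f e + c)" using lev e by blast
    \<comment> \<open>Each added index ties with \<open>e\<close> and contributes \<open>c\<close>,
      which is nonnegative.\<close>
    also have "\<dots> \<le> (\<Sum>i\<in>A'. f i - f e + c)"
      using finA' e c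
    proof (intro sum_mono2, goal_cases)
      case (3 i)
      hence "i \<in> A" "\<not> f i < f e" by (auto simp: A'_def)
      hence "f i = f e" using e(2)[of i] by simp
      thus ?case using c by simp
    qed (auto simp: A'_def)
    also have "\<dots> = sum f A' - real (n - 1) * (f e - c)"
      by (simp add: sum.distrib sum_subtractf cardA' algebra_simps)
    finally have fe: "real (n - 1) * (f e - c) \<le> sum f A'" by simp
    have "sum f A = f e + sum f A'"
      using e finA by (simp add: A'_def sum.remove)
    hence "real (n - 1) * sum f A \<le> real n * sum f A' + real (n - 1) * c"
      using fe n2 by (simp add: algebra_simps of_nat_diff)
    hence "real (n - 1) * sum f A / (real (n - 1) * real n)
        \<le> (real n * sum f A' + real (n - 1) * c) / (real (n - 1) * real n)"
      by (intro divide_right_mono) auto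
    hence "sum f A / real n \<le> sum f A' / real (n - 1) + c * (1 / real n)"
      using n2 by (simp add: add_divide_distrib)
    also have "\<dots> \<le> sum f A' / real (n - 1) + c * ln (real n / real (n - 1))"
      using inverse_le_ln_ratio[OF n2] c by (intro add_left_mono mult_left_mono) auto
    also have "\<dots> \<le> sum f K / real (card J) + c * ln (real (n - 1) / real (card J))
        + c * ln (real n / real (n - 1))"
      using IH K by (simp add: cardA')
    also have "\<dots> \<le> sum f J / real (card J) + c * ln (real (n - 1) / real (card J))
        + c * ln (real n / real (n - 1))"
      using K by (simp add: divide_right_mono)
    also have "\<dots> = sum f J / real (card J) + c * ln (real n / real (card J))"
      using n2 cJ by (simp add: ln_div algebra_simps)
    finally show ?thesis by (simp add: n_def)
  qed
qed

text \<open>\<open>sum_below_level_nonneg\<close> handles only levels up to \<open>x 0\<close>, so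
  the sequence is truncated there; this keeps the value at 0 and can only lower the sum over
  \<open>J\<close>. Comparing \<open>x 0\<close> with the average over all indices costs
  \<open>c\<close>, and passing on to \<open>J\<close> costs the logarithmic term.\<close>

lemma first_le_subset_average:
  fixes x :: "nat \<Rightarrow> real" and c :: real
  assumes step: "\<And>i j. i < j \<Longrightarrow> j < d \<Longrightarrow> real (j - i) * (x i - c) \<le> (\<Sum>l\<in>{i<..j}. x l)"
    and c: "c \<ge> 0" and J: "J \<subseteq> {..<d}" "J \<noteq> {}"
  shows "real (card J) * x 0 \<le> sum x J + real (card J) * (c * (1 + ln (real d / real (card J))))"
proof -
  define f where "f = (\<lambda>i. min (x i) (x 0))"
  have d: "d > 0" using J by auto
  have cJ: "card J > 0" using J finite_subset by (fastforce simp: card_gt_0_iff)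
  have lev: "0 \<le> (\<Sum>i | i \<in> {..<d} \<and> f i < f e. f i - f e + c)" for e
  proof -
    have "{i. i \<in> {..<d} \<and> f i < f e} = {i. i < d \<and> x i < f e}"
      by (auto simp: f_def)
    moreover have "(\<Sum>i | i < d \<and> x i < f e. f i - f e + c) = (\<Sum>i | i < d \<and> x i < f e. x i - f e + c)"
      by (intro sum.cong) (auto simp: f_def)
    moreover have "0 \<le> (\<Sum>i | i < d \<and> x i < f e. x i - f e + c)"
      by (rule sum_below_level_nonneg[of d, OF step]) (auto simp: f_def)
    ultimately show ?thesis by simp
  qed
  have "0 \<le> (\<Sum>i | i \<in> {..<d} \<and> f i < f 0. f i - f 0 + c)" by (rule lev)
  also have "\<dots> \<le> (\<Sum>i<d. f i - f 0 + c)"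
    using c by (intro sum_mono2) (auto simp: f_def)
  also have "\<dots> = sum f {..<d} - real d * (x 0 - c)"
    by (simp add: sum.distrib sum_subtractf algebra_simps f_def)
  finally have "x 0 \<le> c + sum f {..<d} / real d"
    using d by (simp add: field_simps)
  also have "\<dots> \<le> c + (sum f J / real (card J) + c * ln (real d / real (card J)))"
    using average_le_subset_average[OF _ J c lev] by simp
  also have "\<dots> \<le> c + (sum x J / real (card J) + c * ln (real d / real (card J)))"
    by (intro add_mono divide_right_mono sum_mono) (auto simp: f_def)
  finally have "real (card J) * x 0
      \<le> real (card J) * (c + (sum x J / real (card J) + c * ln (real d / real (card J))))"
    by (rule mult_left_mono) simp
  thus ?thesis using cJ by (simp add: algebra_simps)
qed

section \<open>Hermite-type bounds for blocks of an HKZ-reduced basis\<close>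

lemma lattice_of_diff:
  assumes "v \<in> lattice_of bs" "w \<in> lattice_of bs"
  shows "v - w \<in> lattice_of bs"
proof -
  obtain y z :: "nat \<Rightarrow> int" where "v = (\<Sum>i<length bs. of_int (y i) *\<^sub>R bs ! i)"
    "w = (\<Sum>i<length bs. of_int (z i) *\<^sub>R bs ! i)"
    using assms by (auto simp: lattice_of_def)
  hence "v - w = (\<Sum>i<length bs. of_int (y i - z i) *\<^sub>R bs ! i)"
    by (simp add: sum_subtractf scaleR_diff_left)
  thus ?thesis unfolding lattice_of_def by (auto intro!: exI[of _ "\<lambda>i. y i - z i"])
qed

lemma int_multiple_nth_in_lattice_of:
  assumes "p < length bs"
  shows "of_int m *\<^sub>R bs ! p \<in> lattice_of bs"
proof -
  have "(\<Sum>i<length bs. of_int (if i = p then m else 0) *\<^sub>R bs ! i)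
      = (\<Sum>i\<in>{p}. of_int (if i = p then m else 0) *\<^sub>R bs ! i)"
    using assms by (intro sum.mono_neutral_right) auto
  hence "of_int m *\<^sub>R bs ! p = (\<Sum>i<length bs. of_int (if i = p then m else 0) *\<^sub>R bs ! i)"
    by simp
  thus ?thesis
    unfolding lattice_of_def by (auto intro!: exI[of _ "\<lambda>i. if i = p then m else 0"])
qed

text \<open>Back-substitution from \<open>j\<close> down to \<open>i\<close>: subtracting an integer
  multiple of \<open>bs ! p\<close> shifts the coordinate at \<open>p\<close> by that integer and
  leaves the later ones alone. The downward induction starts at \<open>Suc j\<close>, where no digit
  is prescribed.\<close>

lemma lattice_vector_with_digits:
  fixes k :: "nat \<Rightarrow> int"
  assumes "i \<le> j" "j < length bs" and nz: "\<And>l. l \<le> j \<Longrightarrow> gso bs l \<noteq> 0"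
  shows "\<exists>v\<in>lattice_of bs. (\<forall>l>j. v \<bullet> gso bs l = 0) \<and>
           (\<forall>l\<in>{i..j}. \<lfloor>v \<bullet> gso bs l / (norm (gso bs l))\<^sup>2\<rfloor> = k l)"
proof -
  have "i \<le> Suc j" using assms by simp
  thus ?thesis
  proof (induction rule: inc_induct)
    case base
    have "0 \<in> lattice_of bs"
      using int_multiple_nth_in_lattice_of[of j bs 0] assms by simp
    thus ?case by (intro bexI[of _ 0]) auto
  next
    case (step p)
    then obtain w where w: "w \<in> lattice_of bs" "\<forall>l>j. w \<bullet> gso bs l = 0"
      "\<forall>l\<in>{Suc p..j}. \<lfloor>w \<bullet> gso bs l / (norm (gso bs l))\<^sup>2\<rfloor> = k l" by blast
    define m where "m = \<lfloor>w \<bullet> gso bs p / (norm (gso bs p))\<^sup>2\<rfloor> - k p"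
    define v where "v = w - of_int m *\<^sub>R bs ! p"
    have mem: "v \<in> lattice_of bs"
      unfolding v_def using w(1) step assms by (intro lattice_of_diff int_multiple_nth_in_lattice_of) auto
    have same: "v \<bullet> gso bs l = w \<bullet> gso bs l" if "l > p" for l
      using that by (simp add: v_def inner_diff_left nth_inner_gso)
    have "v \<bullet> gso bs p / (norm (gso bs p))\<^sup>2
        = w \<bullet> gso bs p / (norm (gso bs p))\<^sup>2 - of_int m"
      using nz[of p] step by (simp add: v_def inner_diff_left nth_inner_gso diff_divide_distrib)
    hence digit: "\<lfloor>v \<bullet> gso bs p / (norm (gso bs p))\<^sup>2\<rfloor> = k p"
      by (simp only: floor_diff_of_int) (simp add: m_def)
    have "\<forall>l\<in>{p..j}. \<lfloor>v \<bullet> gso bs l / (norm (gso bs l))\<^sup>2\<rfloor> = k l"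
    proof
      fix l assume "l \<in> {p..j}"
      thus "\<lfloor>v \<bullet> gso bs l / (norm (gso bs l))\<^sup>2\<rfloor> = k l"
        using w(3) same[of l] digit by (cases "l = p") auto
    qed
    moreover have "\<forall>l>j. v \<bullet> gso bs l = 0"
      using w(2) same step by auto
    ultimately show ?case using mem by blast
  qed
qed

text \<open>A Hermite-type bound with constant \<open>(2 * n / 3) * 4 powr (1 / n)\<close>. If it
  failed, \<open>exists_short_vector\<close> would give a projected lattice vector shorter than
  \<open>gso bs i\<close>. The 4 is the square of the 2 in the volume condition.\<close>

lemma hkz_block_determinant:
  assumes hkz: "hkz_reduced bs" and ij: "i \<le> j" "j < length bs"
  defines "n \<equiv> Suc j - i"
  shows "(3 * (norm (gso bs i))\<^sup>2 / (2 * real n)) ^ n \<le> 4 * (\<Prod>l=i..j. (norm (gso bs l))\<^sup>2)"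
proof (rule ccontr)
  define r where "r = (\<lambda>l. norm (gso bs l))"
  \<comment> \<open>Chosen so that \<open>2 * n * t^2 = 3 * (r i)^2\<close>, which makes the short
    vector contradict minimality.\<close>
  define t where "t = sqrt (3 * (r i)\<^sup>2 / (2 * real n))"
  have n: "n > 0" using ij by (simp add: n_def)
  have nz: "gso bs l \<noteq> 0" if "l \<le> j" for l
    using hkz_gso_nonzero[OF hkz, of l] that ij by simp
  have r: "r l > 0" if "l \<le> j" for l using nz[OF that] by (simp add: r_def)
  have t2: "t\<^sup>2 = 3 * (r i)\<^sup>2 / (2 * real n)" by (simp add: t_def)
  have t: "t > 0" using r[of i] ij n by (simp add: t_def)
  \<comment> \<open>Coordinates with respect to the normalised Gram-Schmidt vectors. Requiring zeros
    beyond \<open>j\<close> confines the projected norm to the block.\<close>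
  define L where "L = {\<lambda>l. v \<bullet> gso bs l / r l | v. v \<in> lattice_of bs \<and> (\<forall>l>j. v \<bullet> gso bs l = 0)}"
  assume "\<not> ?thesis"
  hence "4 * (\<Prod>l=i..j. (r l)\<^sup>2) < (t\<^sup>2) ^ n" by (simp add: t2 r_def)
  also have "(t\<^sup>2) ^ n = (t ^ n)\<^sup>2"
    by (metis power_mult mult.commute)
  also have "4 * (\<Prod>l=i..j. (r l)\<^sup>2) = (2 * (\<Prod>l=i..j. r l))\<^sup>2"
    by (simp add: power_mult_distrib prod_power_distrib)
  finally have "(2 * (\<Prod>l=i..j. r l))\<^sup>2 < (t ^ n)\<^sup>2" .
  hence "2 * (\<Prod>l=i..j. r l) < t ^ n"
    by (rule power2_less_imp_less) (use t in auto)
  hence vol: "2 * (\<Prod>l\<in>{i..j}. r l) < t ^ card {i..j}" by (simp add: n_def)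
  have "\<exists>c\<in>L. (\<exists>l\<in>{i..j}. c l \<noteq> 0) \<and> 3 * (\<Sum>l\<in>{i..j}. (c l)\<^sup>2) < 2 * real (card {i..j}) * t\<^sup>2"
  proof (rule exists_short_vector[OF _ _ _ t vol])
    show "\<exists>c\<in>L. \<forall>l\<in>{i..j}. \<lfloor>c l / r l\<rfloor> = k l" for k :: "nat \<Rightarrow> int"
    proof -
      obtain v where v: "v \<in> lattice_of bs" "\<forall>l>j. v \<bullet> gso bs l = 0"
        "\<forall>l\<in>{i..j}. \<lfloor>v \<bullet> gso bs l / (norm (gso bs l))\<^sup>2\<rfloor> = k l"
        using lattice_vector_with_digits[OF ij nz] by blast
      show ?thesis
        using v by (intro bexI[of _ "\<lambda>l. v \<bullet> gso bs l / r l"])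
          (auto simp: L_def r_def power2_eq_square)
    qed
    fix a b assume "a \<in> L" "b \<in> L"
    then obtain v w where v: "v \<in> lattice_of bs" "\<forall>l>j. v \<bullet> gso bs l = 0" "a = (\<lambda>l. v \<bullet> gso bs l / r l)"
      and w: "w \<in> lattice_of bs" "\<forall>l>j. w \<bullet> gso bs l = 0" "b = (\<lambda>l. w \<bullet> gso bs l / r l)"
      unfolding L_def by auto
    have "(\<lambda>l. a l - b l) = (\<lambda>l. (v - w) \<bullet> gso bs l / r l)"
      by (simp add: v w inner_diff_left diff_divide_distrib)
    moreover have "\<forall>l>j. (v - w) \<bullet> gso bs l = 0"
      using v w by (simp add: inner_diff_left)
    ultimately show "(\<lambda>l. a l - b l) \<in> L"
      using lattice_of_diff[OF v(1) w(1)] unfolding L_def by blast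
  qed (use ij r in auto)
  then obtain v l where v: "v \<in> lattice_of bs" "\<forall>l>j. v \<bullet> gso bs l = 0"
    and l: "l \<in> {i..j}" "v \<bullet> gso bs l \<noteq> 0"
    and short: "3 * (\<Sum>l=i..j. (v \<bullet> gso bs l / r l)\<^sup>2) < 2 * real n * t\<^sup>2"
    unfolding L_def n_def by auto
  have "(r i)\<^sup>2 \<le> (\<Sum>l=i..<length bs. (v \<bullet> gso bs l)\<^sup>2 / (norm (gso bs l))\<^sup>2)"
    unfolding r_def using l ij by (intro hkz_gso_minimal[OF hkz v(1) _ _ l(2)]) auto
  also have "\<dots> = (\<Sum>l=i..j. (v \<bullet> gso bs l)\<^sup>2 / (norm (gso bs l))\<^sup>2)"
    using v(2) ij by (intro sum.mono_neutral_right) auto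
  finally have "3 * (r i)\<^sup>2 < 2 * real n * t\<^sup>2"
    using short by (simp add: power_divide r_def)
  also have "\<dots> = 3 * (r i)\<^sup>2" using n by (simp add: t2)
  finally show False by simp
qed

text \<open>The vector \<open>bs ! Suc i\<close>, projected orthogonally to the first
  \<open>i\<close> basis vectors, competes with \<open>gso bs i\<close>; size reduction limits its
  component along \<open>gso bs i\<close> to half of that vector.\<close>

lemma hkz_gso_Suc:
  assumes hkz: "hkz_reduced bs" and i: "Suc i < length bs"
  shows "(norm (gso bs i))\<^sup>2 \<le> 4 / 3 * (norm (gso bs (Suc i)))\<^sup>2"
proof -
  let ?r = "\<lambda>l. norm (gso bs l)"
  have nz: "gso bs i \<noteq> 0" "gso bs (Suc i) \<noteq> 0"
    using hkz_gso_nonzero[OF hkz] i by auto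
  have mem: "bs ! Suc i \<in> lattice_of bs"
    using int_multiple_nth_in_lattice_of[OF i, of 1] by simp
  have "size_reduced bs"
    using hkz i by (cases bs) auto
  hence mu: "\<bar>gs_mu bs (Suc i) i\<bar> \<le> 1 / 2"
    using i unfolding size_reduced_def by blast
  have "(?r i)\<^sup>2 \<le> (\<Sum>l=i..<length bs. (bs ! Suc i \<bullet> gso bs l)\<^sup>2 / (?r l)\<^sup>2)"
    using i nz by (intro hkz_gso_minimal[OF hkz mem, of _ "Suc i"]) (auto simp: nth_inner_gso)
  also have "\<dots> = (\<Sum>l\<in>{i, Suc i}. (bs ! Suc i \<bullet> gso bs l)\<^sup>2 / (?r l)\<^sup>2)"
    using i by (intro sum.mono_neutral_right) (auto simp: nth_inner_gso)
  also have "\<dots> = (gs_mu bs (Suc i) i)\<^sup>2 * (?r i)\<^sup>2 + (?r (Suc i))\<^sup>2"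
    using nz by (simp add: nth_inner_gso gs_mu_def power_divide power2_eq_square)
  also have "(gs_mu bs (Suc i) i)\<^sup>2 * (?r i)\<^sup>2 \<le> (1 / 2)\<^sup>2 * (?r i)\<^sup>2"
    using mu by (intro mult_right_mono) (auto simp: abs_le_square_iff[symmetric])
  finally show ?thesis by (simp add: power2_eq_square)
qed

text \<open>Exactly what turns \<open>4 * (2 * n / 3) ^ n\<close> into at most
  \<open>n ^ (n - 1)\<close>.\<close>

lemma four_mult_le_power: "10 \<le> n \<Longrightarrow> 4 * real n \<le> (3 / 2) ^ n"
proof (induction n rule: nat_induct_at_least)
  case base
  show ?case by (simp add: power_divide)
qed auto

text \<open>Raised to the power \<open>(n - 1) / 2\<close>, this compares
  \<open>(4/3) ^ (n * (n - 1) / 2)\<close> with \<open>n ^ (n - 1)\<close>.\<close>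

lemma power_le_square:
  assumes "2 \<le> n" "n < 10"
  shows "(4 / 3 :: real) ^ n \<le> (real n)\<^sup>2"
proof -
  have "n \<in> {2, 3, 4, 5, 6, 7, 8, 9}" using assms by auto
  thus ?thesis by (auto simp: power_divide)
qed

text \<open>This is \<open>\<gamma> ^ n \<le> n ^ (n - 1)\<close> for the Hermite constant \<open>\<gamma>\<close> in dimension
  \<open>n = j - i + 1\<close>. Minkowski's \<open>\<gamma> \<le> n\<close> would not suffice, and for small \<open>n\<close> the bound
  comes from \<open>\<gamma> \<le> (4/3) ^ ((n - 1) / 2)\<close>.\<close>

lemma hkz_ln_gso_le_average:
  assumes hkz: "hkz_reduced bs" and ij: "i < j" "j < length bs"
  shows "real (j - i) * (ln (norm (gso bs i)) - ln (real (Suc j - i)) / 2)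
           \<le> (\<Sum>l\<in>{i<..j}. ln (norm (gso bs l)))"
proof -
  define x where "x = (\<lambda>l. ln (norm (gso bs l)))"
  define n where "n = Suc j - i"
  have n: "n \<ge> 2" "real (j - i) = real n - 1" using ij by (auto simp: n_def)
  have r: "norm (gso bs l) > 0" if "l \<le> j" for l
    using hkz_gso_nonzero[OF hkz, of l] that ij by simp
  have "real (j - i) * (x i - ln (real n) / 2) \<le> (\<Sum>l\<in>{i<..j}. x l)"
  proof (cases "n < 10")
    case True
    define h where "h = ln (4 / 3 :: real) / 2"
    have step: "x l \<le> h + x (Suc l)" if "Suc l \<le> j" for l
    proof -
      have "ln ((norm (gso bs l))\<^sup>2) \<le> ln (4 / 3 * (norm (gso bs (Suc l)))\<^sup>2)"
        using hkz_gso_Suc[OF hkz, of l] r[of l] r[of "Suc l"] that ij by (subst ln_le_cancel_iff) auto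
      moreover have "ln (4 / 3 * (norm (gso bs (Suc l)))\<^sup>2) = 2 * h + 2 * x (Suc l)"
        using r[of "Suc l"] that by (subst ln_mult) (auto simp: x_def h_def ln_realpow)
      ultimately show ?thesis using r[of l] that by (simp add: x_def ln_realpow)
    qed
    have chain: "x i \<le> real m * h + x (i + m)" if "i + m \<le> j" for m
      using that
    proof (induction m)
      case (Suc m)
      thus ?case using step[of "i + m"] by (simp add: algebra_simps)
    qed simp
    \<comment> \<open>The chained inequalities are added over all \<open>l\<close> in the block; the
      gaps \<open>l - i\<close> sum to \<open>(n - 1) * n / 2\<close>.\<close>
    have "real (j - i) * x i = (\<Sum>l\<in>{i<..j}. x i)" by simp
    also have "\<dots> \<le> (\<Sum>l\<in>{i<..j}. real (l - i) * h + x l)"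
    proof (rule sum_mono)
      fix l assume "l \<in> {i<..j}"
      thus "x i \<le> real (l - i) * h + x l" using chain[of "l - i"] by simp
    qed
    also have "\<dots> = h * (\<Sum>l\<in>{i<..j}. real (l - i)) + (\<Sum>l\<in>{i<..j}. x l)"
      by (simp add: sum.distrib sum_distrib_left mult.commute)
    also have "(\<Sum>l\<in>{i<..j}. real (l - i)) = (\<Sum>m=1..j - i. real m)"
      by (rule sum.reindex_bij_witness[of _ "\<lambda>m. m + i" "\<lambda>l. l - i"]) auto
    also have "\<dots> = real (j - i) * (real (j - i) + 1) / 2"
      using double_gauss_sum_from_Suc_0[of "j - i", where ?'a = real] unfolding One_nat_def by linarith
    also have "real (j - i) + 1 = real n" using n by simp
    finally have "real (j - i) * x i \<le> real (j - i) * (real n * h) / 2 + (\<Sum>l\<in>{i<..j}. x l)"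
      by (simp add: algebra_simps)
    moreover have "real n * h \<le> ln (real n)"
    proof -
      have "ln ((4 / 3 :: real) ^ n) \<le> ln ((real n)\<^sup>2)"
        using power_le_square[OF n(1) True] n by (subst ln_le_cancel_iff) auto
      thus ?thesis using n by (simp add: h_def ln_realpow)
    qed
    hence "real (j - i) * (real n * h) \<le> real (j - i) * ln (real n)"
      by (intro mult_left_mono) auto
    ultimately show ?thesis by (simp add: algebra_simps)
  next
    case False
    define P where "P = (\<Prod>l=i..j. (norm (gso bs l))\<^sup>2)"
    have P: "P > 0" unfolding P_def using r by (intro prod_pos) auto
    have "ln ((3 * (norm (gso bs i))\<^sup>2 / (2 * real n)) ^ n) \<le> ln (4 * P)"
      using hkz_block_determinant[OF hkz _ ij(2), of i] ij n P r[of i]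
      unfolding n_def[symmetric] P_def[symmetric] by (subst ln_le_cancel_iff) auto
    moreover have "ln ((3 * (norm (gso bs i))\<^sup>2 / (2 * real n)) ^ n)
        = real n * (ln (3 / 2) + 2 * x i - ln (real n))"
      using r[of i] ij n by (simp add: ln_realpow ln_div ln_mult x_def)
    \<comment> \<open>Splitting off index \<open>i\<close> cancels one of the \<open>n\<close>
      copies of \<open>2 * x i\<close> on the left, leaving the factor \<open>n - 1\<close>.\<close>
    moreover have "ln (4 * P) = ln 4 + 2 * (x i + (\<Sum>l\<in>{i<..j}. x l))"
    proof -
      have "ln P = (\<Sum>l=i..j. 2 * x l)"
        unfolding P_def using r by (subst ln_prod) (auto simp: x_def ln_realpow intro!: sum.cong)
      also have "\<dots> = 2 * (x i + (\<Sum>l\<in>{i<..j}. x l))"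
        using ij by (simp add: sum.head sum_distrib_left[symmetric])
      finally show ?thesis using P by (simp add: ln_mult)
    qed
    moreover have "ln (4 * real n) \<le> ln ((3 / 2) ^ n)"
      using four_mult_le_power[of n] False n by (subst ln_le_cancel_iff) auto
    hence "ln 4 + ln (real n) \<le> real n * ln (3 / 2)"
      using n by (simp add: ln_mult ln_realpow)
    ultimately show ?thesis unfolding n(2) by (simp add: algebra_simps diff_divide_distrib)
  qed
  thus ?thesis by (simp add: x_def n_def)
qed

section \<open>The two inequalities of the theorem\<close>

text \<open>This is \<open>ln z \<le> z - 1\<close> at \<open>z = y / exp 1\<close>. With
  \<open>y = d / k\<close> it produces the term \<open>d / exp 1\<close> in the second
  bound.\<close>

lemma ln_le_divide_exp_1:
  fixes y :: real
  assumes "y > 0"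
  shows "ln y \<le> y / exp 1"
proof -
  have "ln (y / exp 1) \<le> y / exp 1 - 1" using assms by (intro ln_le_minus_one) simp
  thus ?thesis using assms by (simp add: ln_div)
qed

theorem theorem3:
  fixes bs :: "'a::euclidean_space list" and I :: "nat set"
  defines "d \<equiv> length bs"
  assumes "is_basis bs" and "hkz_reduced bs" and "d \<ge> 2"
    and "I \<subseteq> {..<d}" and "I \<noteq> {}"
  shows "norm (bs ! 0) ^ card I / (\<Prod>i\<in>I. norm (gso bs i))
           \<le> sqrt (real d) powr (real (card I) * (1 + ln (real d / real (card I))))
       \<and> sqrt (real d) powr (real (card I) * (1 + ln (real d / real (card I))))
           \<le> sqrt (real d) powr (real d / exp 1 + real (card I))"
proof
  define x where "x = (\<lambda>l. ln (norm (gso bs l)))"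
  define c where "c = ln (sqrt (real d))"
  define k where "k = card I"
  have k: "k > 0" unfolding k_def using assms(5,6) finite_subset by (fastforce simp: card_gt_0_iff)
  have d: "d \<ge> 2" by fact
  have c: "c \<ge> 0" "c = ln (real d) / 2" using d by (auto simp: c_def ln_sqrt)
  have r: "norm (gso bs l) > 0" if "l < d" for l
    using hkz_gso_nonzero[OF assms(3)] that by (simp add: d_def)
  have step: "real (j - i) * (x i - c) \<le> (\<Sum>l\<in>{i<..j}. x l)" if "i < j" "j < d" for i j
  proof -
    \<comment> \<open>Every block has length at most \<open>d\<close>, so its own loss is at most
      the uniform \<open>c\<close>.\<close>
    have "real (j - i) * (x i - c) \<le> real (j - i) * (x i - ln (real (Suc j - i)) / 2)"
      using that by (intro mult_left_mono) (auto simp: c(2))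
    also have "\<dots> \<le> (\<Sum>l\<in>{i<..j}. x l)"
      using hkz_ln_gso_le_average[OF assms(3), of i j] that by (simp add: x_def d_def)
    finally show ?thesis .
  qed
  have main: "real k * x 0 \<le> sum x I + real k * (c * (1 + ln (real d / real k)))"
    unfolding k_def using step c(1) assms(5,6) by (rule first_le_subset_average)
  have "norm (bs ! 0) ^ k / (\<Prod>i\<in>I. norm (gso bs i)) = exp (real k * x 0) / exp (sum x I)"
  proof -
    have "norm (bs ! 0) ^ k = exp (real k * x 0)"
      using r[of 0] d by (simp add: x_def gso_0 exp_of_nat_mult)
    moreover have "(\<Prod>i\<in>I. norm (gso bs i)) = exp (sum x I)"
      using r assms(5) finite_subset[OF assms(5)] by (auto simp: exp_sum x_def intro!: prod.cong)
    ultimately show ?thesis by simp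
  qed
  also have "\<dots> \<le> exp (real k * (1 + ln (real d / real k)) * c)"
    using main by (simp add: algebra_simps flip: exp_diff)
  also have "\<dots> = sqrt (real d) powr (real k * (1 + ln (real d / real k)))"
    using d by (simp add: powr_def c_def)
  finally show "norm (bs ! 0) ^ card I / (\<Prod>i\<in>I. norm (gso bs i))
           \<le> sqrt (real d) powr (real (card I) * (1 + ln (real d / real (card I))))"
    by (simp add: k_def)
  have "real k * ln (real d / real k) \<le> real k * (real d / real k / exp 1)"
    using d k by (intro mult_left_mono ln_le_divide_exp_1) auto
  hence "real k * (1 + ln (real d / real k)) \<le> real d / exp 1 + real k"
    using k by (simp add: algebra_simps)
  thus "sqrt (real d) powr (real (card I) * (1 + ln (real d / real (card I))))
           \<le> sqrt (real d) powr (real d / exp 1 + real (card I))"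
    using d by (intro powr_mono) (auto simp: k_def)
qed

end
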